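(* Let $\mathcal{G} = (P, X, d, \leqslant, \leqslant^*, \vartriangleleft)$ be an approximate Gowers space satisfying the pigeonhole principle, and let $\mathcal{X}\subseteq X^\omega$ be a strategically Ramsey set. Then for every $p\in P$ and every sequence $\Delta$ of positive real numbers, there exists $q\leqslant p$ such that in the game $F_q$, player I either has a strategy to reach $\mathcal{X}^c$, or has a strategy to reach $(\mathcal{X})_\Delta$.
   Context: An \emph{approximate Gowers space} is a sextuple $\mathcal{G} = (P, X, d, \leqslant, \leqslant^*, \vartriangleleft)$, where $P$ is a nonempty set, $X$ is a nonempty Polish space, $d$ is a compatible distance on $X$, $\leqslant$ and $\leqslant^*$ are quasiorders on $P$, and $\vartriangleleft\ \subseteq X\times P$, such that: (1) for all $p,q\in P$, if $p\leqslant q$ then $p\leqslant^* q$; (2) for all $p,q\in P$, if $p\leqslant^* q$ then there is $r\in P$ with $r\leqslant p$, $r\leqslant q$ and $p\leqslant^* r$; (3) for every $\leqslant$-decreasing sequence $(p_i)_{i\in\omega}$ in $P$ there is $p^*\in P$ with $p^*\leqslant^* p_i$ for all $i$; (4) for every $p\in P$ there is $x\in X$ with $x\vartriangleleft p$; (5) for every $x\in X$ and $p,q\in P$, if $x\vartriangleleft p$ and $p\leqslant q$ then $x\vartriangleleft q$. Write $p\lessapprox q$ when $p\leqslant q$ and $q\leqslant^* p$. In the game $G_p$ ($p\in P$): I plays $p_0$, II plays $x_0$, I plays $p_1$, II plays $x_1$, etc., with $p_i\in P$, $x_i\in X$. Rule for I: $p_i\leqslant p$. Rule for II: $x_i\vartriangleleft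 p_i$. The outcome is $(x_i)_{i\in\omega}\in X^\omega$. The game $F_p$ is defined in the same way except that I is moreover required to play $p_i\lessapprox p$. A player \emph{has a strategy to reach} a set $\mathcal{Y}$ in a game if she/he has a winning strategy in the game with those rules and whose winning condition for that player is that the outcome belongs to $\mathcal{Y}$. For $A\subseteq X$ and $\delta>0$, $(A)_\delta=\{x\in X\mid\exists y\in A\ d(x,y)\leqslant\delta\}$. For $\mathcal{X}\subseteq X^\omega$ and a sequence $\Delta=(\Delta_n)_{n\in\omega}$ of positive reals, $(\mathcal{X})_\Delta = \{(x_n)\in X^\omega \mid \exists (y_n)\in\mathcal{X}\ \forall n\ d(x_n,y_n)\leqslant\Delta_n\}$. For $q\in P$, $A\subseteq X$, write $q\subseteq A$ if every $x\in X$ with $x\vartriangleleft q$ is in $A$. $\mathcal{G}$ satisfies the \emph{pigeonhole principle} if for every $p\in P$, $A\subseteq X$ and $\delta>0$ there is $q\leqslant p$ such that either $q\subseteq A^c$ or $q\subseteq (A)_\delta$. $\mathcal{X}\subseteq X^\omega$ is \emph{strategically Ramsey} if for every sequence $\Delta$ of positive reals and every $p\in P$ there is $q\leqslant p$ such that either I has a strategy in $F_q$ to reach $\mathcal{X}^c$, or II has a strategy in $G_q$ to reach $(\mathcal{X})_\Delta$. *)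

theory Defs
  imports "HOL-Analysis.Analysis"
begin

definition Polish_space :: "'x topology \<Rightarrow> bool" where
  "Polish_space T \<longleftrightarrow> completely_metrizable_space T \<and> separable_space T"

text \<open>The space \<open>X\<close> is carried by the field \<open>pts\<close> as a topology; its underlying set is
  \<open>topspace (pts G)\<close>. The compatible distance \<open>distance G\<close> need not be complete.\<close>

record ('p, 'x) gowers_sextuple =
  conds :: "'p set"
  pts :: "'x topology"
  distance :: "'x \<Rightarrow> 'x \<Rightarrow> real"
  below :: "'p \<Rightarrow> 'p \<Rightarrow> bool" (infix "\<preceq>\<index>" 50)
  below_star :: "'p \<Rightarrow> 'p \<Rightarrow> bool" (infix "\<preceq>*\<index>" 50)
  belongs :: "'x \<Rightarrow> 'p \<Rightarrow> bool" (infix "\<triangleleft>\<index>" 50)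

locale approximate_gowers_space =
  fixes G :: "('p, 'x) gowers_sextuple" (structure)
  assumes conds_nonempty: "conds G \<noteq> {}"
    and pts_nonempty: "topspace (pts G) \<noteq> {}"
    and pts_Polish: "Polish_space (pts G)"
    and metric: "Metric_space (topspace (pts G)) (distance G)"
    and metric_compatible:
      "Metric_space.mtopology (topspace (pts G)) (distance G) = pts G"
    and below_preorder: "preorder_on (conds G) {(p, q). p \<preceq> q}"
    and below_star_preorder: "preorder_on (conds G) {(p, q). p \<preceq>* q}"
    and belongs_subset: "{(x, p). x \<triangleleft> p} \<subseteq> topspace (pts G) \<times> conds G"
    and below_imp_below_star:
      "\<lbrakk>p \<in> conds G; q \<in> conds G; p \<preceq> q\<rbrakk> \<Longrightarrow> p \<preceq>* q"
    and below_star_refine: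
      "\<lbrakk>p \<in> conds G; q \<in> conds G; p \<preceq>* q\<rbrakk>
        \<Longrightarrow> \<exists>r \<in> conds G. r \<preceq> p \<and> r \<preceq> q \<and> p \<preceq>* r"
    and diagonalization:
      "\<lbrakk>\<And>i. s i \<in> conds G; \<And>i. s (Suc i) \<preceq> s i\<rbrakk>
        \<Longrightarrow> \<exists>p \<in> conds G. \<forall>i::nat. p \<preceq>* s i"
    and inhabited: "p \<in> conds G \<Longrightarrow> \<exists>x \<in> topspace (pts G). x \<triangleleft> p"
    and belongs_mono:
      "\<lbrakk>x \<in> topspace (pts G); p \<in> conds G; q \<in> conds G; x \<triangleleft> p; p \<preceq> q\<rbrakk>
        \<Longrightarrow> x \<triangleleft> q"

definition below_approx ::
  "('p, 'x) gowers_sextuple \<Rightarrow> 'p \<Rightarrow> 'p \<Rightarrow> bool" (infix "\<lessapprox>\<index>" 50)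
  where "p \<lessapprox>\<^bsub>G\<^esub> q \<longleftrightarrow> p \<preceq>\<^bsub>G\<^esub> q \<and> q \<preceq>*\<^bsub>G\<^esub> p"

definition seqs :: "('p, 'x) gowers_sextuple \<Rightarrow> (nat \<Rightarrow> 'x) set" where
  "seqs G = {x. \<forall>n. x n \<in> topspace (pts G)}"

definition fatten ::
  "('p, 'x) gowers_sextuple \<Rightarrow> real \<Rightarrow> 'x set \<Rightarrow> 'x set" where
  "fatten G \<delta> A = {x \<in> topspace (pts G). \<exists>y \<in> A. distance G x y \<le> \<delta>}"

definition fatten_seqs ::
  "('p, 'x) gowers_sextuple \<Rightarrow> (nat \<Rightarrow> real) \<Rightarrow> (nat \<Rightarrow> 'x) set \<Rightarrow> (nat \<Rightarrow> 'x) set" where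
  "fatten_seqs G \<Delta> S = {x \<in> seqs G. \<exists>y \<in> S. \<forall>n. distance G (x n) (y n) \<le> \<Delta> n}"

definition below_set :: "('p, 'x) gowers_sextuple \<Rightarrow> 'p \<Rightarrow> 'x set \<Rightarrow> bool" where
  "below_set G q A \<longleftrightarrow> (\<forall>x \<in> topspace (pts G). x \<triangleleft>\<^bsub>G\<^esub> q \<longrightarrow> x \<in> A)"

definition pigeonhole_principle :: "('p, 'x) gowers_sextuple \<Rightarrow> bool" where
  "pigeonhole_principle G \<longleftrightarrow>
    (\<forall>p \<in> conds G. \<forall>A \<subseteq> topspace (pts G). \<forall>\<delta>>0. \<exists>q \<in> conds G. q \<preceq>\<^bsub>G\<^esub> p \<and>
      (below_set G q (topspace (pts G) - A) \<or> below_set G q (fatten G \<delta> A)))"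

text \<open>The two games differ only in the set \<open>M\<close> of moves allowed to I. A strategy maps the finite
  list of the opponent's previous moves to the next move: for I, whose first move is made on the
  empty list, a function \<open>\<sigma> :: 'x list \<Rightarrow> 'p\<close>; for II, who has seen at least one move, a function
  \<open>\<tau> :: 'p list \<Rightarrow> 'x\<close>. The first player to break a rule loses, so a winning strategy has to make
  legal moves as long as the opponent does, and has to give an outcome in the target set if the
  opponent never breaks a rule.\<close>

definition legal_II ::
  "('p, 'x) gowers_sextuple \<Rightarrow> 'p \<Rightarrow> 'x \<Rightarrow> bool" where
  "legal_II G p x \<longleftrightarrow> x \<in> topspace (pts G) \<and> x \<triangleleft>\<^bsub>G\<^esub> p"

definition winning_I ::
  "('p, 'x) gowers_sextuple \<Rightarrow> 'p set \<Rightarrow> (nat \<Rightarrow> 'x) set \<Rightarrow> ('x list \<Rightarrow> 'p) \<Rightarrow> bool" where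
  "winning_I G M Y \<sigma> \<longleftrightarrow>
    (\<forall>x p. (\<forall>n. p n = \<sigma> (map x [0..<n])) \<longrightarrow>
      (\<forall>n. (\<forall>i<n. legal_II G (p i) (x i)) \<longrightarrow> p n \<in> M) \<and>
      ((\<forall>n. legal_II G (p n) (x n)) \<longrightarrow> x \<in> Y))"

definition winning_II ::
  "('p, 'x) gowers_sextuple \<Rightarrow> 'p set \<Rightarrow> (nat \<Rightarrow> 'x) set \<Rightarrow> ('p list \<Rightarrow> 'x) \<Rightarrow> bool" where
  "winning_II G M Y \<tau> \<longleftrightarrow>
    (\<forall>p x. (\<forall>n. x n = \<tau> (map p [0..<Suc n])) \<longrightarrow>
      (\<forall>n. (\<forall>i\<le>n. p i \<in> M) \<longrightarrow> legal_II G (p n) (x n)) \<and>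
      ((\<forall>n. p n \<in> M) \<longrightarrow> x \<in> Y))"

definition moves_G :: "('p, 'x) gowers_sextuple \<Rightarrow> 'p \<Rightarrow> 'p set" where
  "moves_G G p = {r \<in> conds G. r \<preceq>\<^bsub>G\<^esub> p}"

definition moves_F :: "('p, 'x) gowers_sextuple \<Rightarrow> 'p \<Rightarrow> 'p set" where
  "moves_F G p = {r \<in> conds G. r \<lessapprox>\<^bsub>G\<^esub> p}"

definition I_reaches_in_F ::
  "('p, 'x) gowers_sextuple \<Rightarrow> 'p \<Rightarrow> (nat \<Rightarrow> 'x) set \<Rightarrow> bool" where
  "I_reaches_in_F G p Y \<longleftrightarrow> (\<exists>\<sigma>. winning_I G (moves_F G p) Y \<sigma>)"

definition II_reaches_in_G ::
  "('p, 'x) gowers_sextuple \<Rightarrow> 'p \<Rightarrow> (nat \<Rightarrow> 'x) set \<Rightarrow> bool" where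
  "II_reaches_in_G G p Y \<longleftrightarrow> (\<exists>\<tau>. winning_II G (moves_G G p) Y \<tau>)"

definition strategically_Ramsey ::
  "('p, 'x) gowers_sextuple \<Rightarrow> (nat \<Rightarrow> 'x) set \<Rightarrow> bool" where
  "strategically_Ramsey G S \<longleftrightarrow> S \<subseteq> seqs G \<and>
    (\<forall>\<Delta>. (\<forall>n. \<Delta> n > 0) \<longrightarrow> (\<forall>p \<in> conds G. \<exists>q \<in> conds G. q \<preceq>\<^bsub>G\<^esub> p \<and>
      (I_reaches_in_F G q (seqs G - S) \<or> II_reaches_in_G G q (fatten_seqs G \<Delta> S))))"

end

theory Submission
  imports Defs
begin

text \<open>Under the pigeonhole principle, a strategy \<open>\<tau>\<close> of II in \<open>G\<^sub>p\<close> can be turned, up to a small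
  error, into a strategy of I in \<open>F\<^sub>q\<close> for some \<open>q\<close> below \<open>p\<close>. Consider a position of \<open>G\<^sub>p\<close> in which
  it is I's turn, and let \<open>A\<close> be the set of all points with which \<open>\<tau>\<close> can answer the next move.
  No condition \<open>r\<close> below \<open>p\<close> avoids \<open>A\<close>, because the answer of \<open>\<tau>\<close> to \<open>r\<close> belongs to
  both. The pigeonhole principle therefore leaves only the other alternative: below each condition
  there is one all of whose points are close to \<open>A\<close>. If I plays such a condition in \<open>F\<^sub>q\<close>, then
  every point that II can play is close to an answer of \<open>\<tau>\<close> to some move \<open>r\<close>; I adds \<open>r\<close> to a
  play of \<open>G\<^sub>p\<close> simulated on the side and goes on from there. The outcome in \<open>F\<^sub>q\<close> is then close to
  the outcome in \<open>G\<^sub>p\<close> (lemma \<open>I_shadows_II\<close>).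

  A single \<open>q\<close> has to serve all the positions that can be reached in the simulation. The diagonalization
  axiom handles countably many requirements (lemma \<open>fusion\<close>). Since the space is separable,
  countably many moves in each position suffice to approximate all answers of \<open>\<tau>\<close>
  (lemma \<open>countable_dense_subfamily\<close>), so the simulation can be confined to a countable tree of
  positions (lemma \<open>countable_move_tree\<close>).

  The theorem follows by splitting \<open>\<Delta>\<close> into two halves, one for the strategic Ramsey property and
  one for the passage from II to I.\<close>

section \<open>Countable approximation of families of points\<close>

text \<open>A dense set need not meet the given family, so each dense point and each scale \<open>1 / (n + 1)\<close>
  selects a member of the family within that scale, if there is one.\<close>

lemma (in Metric_space) countable_dense_subfamily:
  assumes sep: "separable_space mtopology" and f: "\<And>i. i \<in> I \<Longrightarrow> f i \<in> M"
  obtains J where "countable J" "J \<subseteq> I"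
    "\<And>i e. \<lbrakk>i \<in> I; e > 0\<rbrakk> \<Longrightarrow> \<exists>j\<in>J. d (f i) (f j) < e"
proof -
  obtain C where C: "countable C" "C \<subseteq> M" "mtopology closure_of C = M"
    using sep by (auto simp: separable_space_def)
  define near where "near = (\<lambda>(c, n::nat). {i \<in> I. d c (f i) < 1 / real (Suc n)})"
  define K where "K = {k \<in> C \<times> UNIV. near k \<noteq> {}}"
  define J where "J = (\<lambda>k. SOME i. i \<in> near k) ` K"
  have pick: "(SOME i. i \<in> near k) \<in> near k" if "k \<in> K" for k
    using that some_in_eq by (auto simp: K_def)
  have "countable K"
    unfolding K_def using C(1) by (intro countable_subset[OF _ countable_SIGMA]) auto
  then have "countable J"
    unfolding J_def by simp
  moreover have "J \<subseteq> I"
    using pick unfolding J_def near_def by fastforce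
  moreover have "\<exists>j\<in>J. d (f i) (f j) < e" if i: "i \<in> I" and e: "e > 0" for i e
  proof -
    obtain n where n: "1 / real (Suc n) < e / 2"
      using nat_approx_posE[of "e / 2"] e by auto
    have "f i \<in> mtopology closure_of C"
      using C(3) f i by simp
    then obtain c where c: "c \<in> C" "d (f i) c < 1 / real (Suc n)"
      unfolding metric_closure_of
      by (smt (verit) in_mball mem_Collect_eq of_nat_0_less_iff zero_less_Suc zero_less_divide_1_iff)
    then have k: "(c, n) \<in> K"
      using i by (auto simp: K_def near_def commute)
    define j where "j = (SOME i. i \<in> near (c, n))"
    have "j \<in> J"
      unfolding J_def j_def using k by (rule imageI)
    moreover have "j \<in> near (c, n)"
      using pick[OF k] by (simp add: j_def)
    ultimately have j: "j \<in> J" "j \<in> I" "d c (f j) < 1 / real (Suc n)"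
      by (simp_all add: near_def)
    have "d (f i) (f j) \<le> d (f i) c + d c (f j)"
      using triangle f i j C(2) c(1) by blast
    then show ?thesis
      using j c(2) n by (intro bexI[of _ j]) linarith+
  qed
  ultimately show thesis
    using that by blast
qed

text \<open>A position of the game is recorded by the moves of I alone, since the strategy of II determines
  the rest; \<open>J s\<close> contains the moves that I is allowed to consider in position \<open>s\<close>.\<close>

inductive_set move_tree :: "('p list \<Rightarrow> 'p set) \<Rightarrow> 'p list set" for J where
  Nil: "[] \<in> move_tree J"
| snoc: "\<lbrakk>s \<in> move_tree J; r \<in> J s\<rbrakk> \<Longrightarrow> s @ [r] \<in> move_tree J"

lemma countable_move_tree:
  assumes "\<And>s. s \<in> move_tree J \<Longrightarrow> countable (J s)"
  shows "countable (move_tree J)"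
proof -
  have level: "countable {s \<in> move_tree J. length s = n}" for n
  proof (induction n)
    case 0
    have "{s \<in> move_tree J. length s = 0} \<subseteq> {[]}" by auto
    then show ?case by (rule countable_subset) simp
  next
    case (Suc n)
    let ?L = "{s \<in> move_tree J. length s = n}"
    have "{s \<in> move_tree J. length s = Suc n} \<subseteq> (\<Union>s\<in>?L. (\<lambda>r. s @ [r]) ` J s)"
    proof
      fix s assume "s \<in> {s \<in> move_tree J. length s = Suc n}"
      then have "s \<in> move_tree J" "length s = Suc n" by auto
      then show "s \<in> (\<Union>s\<in>?L. (\<lambda>r. s @ [r]) ` J s)"
        by cases auto
    qed
    moreover have "countable (\<Union>s\<in>?L. (\<lambda>r. s @ [r]) ` J s)"
      using Suc assms by auto
    ultimately show ?case by (rule countable_subset)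
  qed
  have "countable (\<Union>n. {s \<in> move_tree J. length s = n})"
    by (rule countable_UN[OF countableI_type level])
  also have "(\<Union>n. {s \<in> move_tree J. length s = n}) = move_tree J" by blast
  finally show ?thesis .
qed

lemma move_tree_subset_lists:
  assumes "\<And>s. J s \<subseteq> M"
  shows "move_tree J \<subseteq> lists M"
proof
  fix s assume "s \<in> move_tree J"
  then show "s \<in> lists M" by induction (use assms in auto)
qed

section \<open>Fusion\<close>

context approximate_gowers_space
begin

lemma below_refl: "a \<in> conds G \<Longrightarrow> a \<preceq> a"
  using below_preorder by (auto simp: preorder_on_def refl_on_def)

lemma below_trans: "\<lbrakk>a \<preceq> b; b \<preceq> c\<rbrakk> \<Longrightarrow> a \<preceq> c"
  using below_preorder by (auto simp: preorder_on_def dest: transD)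

lemma below_star_trans: "\<lbrakk>a \<preceq>* b; b \<preceq>* c\<rbrakk> \<Longrightarrow> a \<preceq>* c"
  using below_star_preorder by (auto simp: preorder_on_def dest: transD)

text \<open>Each \<open>Q k\<close> is dense below \<open>p\<close>, so a decreasing sequence meets them in turn, and the diagonalization
  axiom gives a condition \<open>\<preceq>*\<close>-below all its members, from which one passes to \<open>q\<close> below \<open>p\<close>.
  Since \<open>Q k\<close> is inherited by smaller conditions, a common refinement of \<open>q\<close> and the \<open>k\<close>-th member
  satisfies \<open>Q k\<close>, and it can be chosen among the conditions that I may play in \<open>F\<^sub>q\<close>.\<close>

lemma fusion:
  fixes Q :: "nat \<Rightarrow> 'p \<Rightarrow> bool"
  assumes p: "p \<in> conds G"
    and dense: "\<And>k a. \<lbrakk>a \<in> conds G; a \<preceq> p\<rbrakk> \<Longrightarrow> \<exists>b\<in>conds G. b \<preceq> a \<and> Q k b"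
    and hereditary: "\<And>k a b. \<lbrakk>a \<in> conds G; b \<in> conds G; b \<preceq> a; Q k a\<rbrakk> \<Longrightarrow> Q k b"
  obtains q where "q \<in> conds G" "q \<preceq> p" "\<And>k. \<exists>r\<in>moves_F G q. Q k r"
proof -
  have "\<exists>f. \<forall>n. (f n \<in> conds G \<and> f n \<preceq> p \<and> Q n (f n)) \<and> f (Suc n) \<preceq> f n"
  proof (rule dependent_nat_choice)
    show "\<exists>a. a \<in> conds G \<and> a \<preceq> p \<and> Q 0 a"
      using dense[OF p below_refl[OF p]] by blast
    show "\<exists>b. (b \<in> conds G \<and> b \<preceq> p \<and> Q (Suc n) b) \<and> b \<preceq> a"
      if "a \<in> conds G \<and> a \<preceq> p \<and> Q n a" for a n
      using that dense below_trans by meson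
  qed
  then obtain f where f: "\<And>n. f n \<in> conds G" "\<And>n. f n \<preceq> p" "\<And>n. Q n (f n)"
    "\<And>n. f (Suc n) \<preceq> f n"
    by blast
  obtain l where l: "l \<in> conds G" "\<And>n. l \<preceq>* f n"
    using diagonalization[of f] f(1,4) by blast
  have "l \<preceq>* p"
    using below_star_trans[OF l(2) below_imp_below_star[OF f(1) p f(2)]] .
  then obtain q where q: "q \<in> conds G" "q \<preceq> l" "q \<preceq> p"
    using below_star_refine[OF l(1) p] by blast
  have "\<exists>r\<in>moves_F G q. Q k r" for k
  proof -
    have "q \<preceq>* f k"
      using below_star_trans[OF below_imp_below_star[OF q(1) l(1) q(2)] l(2)] .
    then obtain r where r: "r \<in> conds G" "r \<preceq> q" "r \<preceq> f k" "q \<preceq>* r"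
      using below_star_refine[OF q(1) f(1)] by blast
    then show ?thesis
      using hereditary[OF f(1) r(1) r(3) f(3)]
      by (auto simp: moves_F_def below_approx_def)
  qed
  with q show thesis using that by blast
qed

lemma below_set_mono:
  assumes "below_set G a A" "a \<in> conds G" "b \<in> conds G" "b \<preceq> a"
  shows "below_set G b A"
  using assms belongs_mono unfolding below_set_def by blast

section \<open>Turning a strategy of II into a strategy of I\<close>

lemma winning_II_legal:
  assumes "winning_II G M Y \<tau>" "s \<in> lists M" "r \<in> M"
  shows "legal_II G r (\<tau> (s @ [r]))"
proof -
  \<comment> \<open>Winning is a statement about infinite plays, so \<open>s\<close> is prolonged by repeating \<open>r\<close> for ever.\<close>
  define m where "m i = (if i < length s then s ! i else r)" for i
  have "map m [0..<length s] = s"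
    by (rule nth_equalityI) (auto simp: m_def)
  then have "map m [0..<Suc (length s)] = s @ [r]"
    by (simp add: m_def)
  moreover have "\<And>i. m i \<in> M"
    using assms(2,3) by (auto simp: m_def in_lists_conv_set)
  then have "legal_II G (m (length s)) (\<tau> (map m [0..<Suc (length s)]))"
    using assms(1)[unfolded winning_II_def, rule_format,
        of "\<lambda>n. \<tau> (map m [0..<Suc n])" m, OF refl] by blast
  ultimately show ?thesis
    by (simp add: m_def)
qed

text \<open>Whatever \<open>b\<close> below \<open>a\<close> the pigeonhole principle provides, I may play it, and the answer to
  \<open>b\<close> is a point of \<open>b\<close>. Hence \<open>b\<close> cannot avoid the set of answers.\<close>

lemma pigeonhole_near_answers:
  assumes pigeonhole: "pigeonhole_principle G" and a: "a \<in> M" and e: "e > 0"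
    and M: "M \<subseteq> conds G" "\<And>a b. \<lbrakk>a \<in> M; b \<in> conds G; b \<preceq> a\<rbrakk> \<Longrightarrow> b \<in> M"
    and answer: "\<And>r. r \<in> M \<Longrightarrow> legal_II G r (g r)"
  shows "\<exists>b\<in>conds G. b \<preceq> a \<and> below_set G b (fatten G e (g ` M))"
proof -
  have "g ` M \<subseteq> topspace (pts G)"
    using answer by (auto simp: legal_II_def)
  then obtain b where b: "b \<in> conds G" "b \<preceq> a"
    "below_set G b (topspace (pts G) - g ` M) \<or> below_set G b (fatten G e (g ` M))"
    using pigeonhole a e M(1) unfolding pigeonhole_principle_def by blast
  then have "b \<in> M"
    using M(2) a by blast
  then have "\<not> below_set G b (topspace (pts G) - g ` M)"
    using answer[of b] by (auto simp: below_set_def legal_II_def)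
  with b show ?thesis by blast
qed

text \<open>The simulation: \<open>\<pi> s\<close> is the condition that I plays when the simulated play has reached
  the position \<open>s\<close>, and \<open>\<rho> s x\<close> is the move of I in the simulated play whose answer approximates
  the point \<open>x\<close> that II has just played.\<close>

lemma I_shadows_II:
  assumes \<tau>: "winning_II G M Y \<tau>"
    and T: "T \<subseteq> lists M" "[] \<in> T"
    and \<pi>: "\<And>s. s \<in> T \<Longrightarrow> \<pi> s \<in> N"
    and respond: "\<And>s x. \<lbrakk>s \<in> T; legal_II G (\<pi> s) x\<rbrakk>
      \<Longrightarrow> \<exists>r. s @ [r] \<in> T \<and> distance G x (\<tau> (s @ [r])) \<le> \<Delta> (length s)"
  shows "\<exists>\<sigma>. winning_I G N (fatten_seqs G \<Delta> Y) \<sigma>"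
proof -
  define \<rho> where
    "\<rho> s x = (SOME r. s @ [r] \<in> T \<and> distance G x (\<tau> (s @ [r])) \<le> \<Delta> (length s))" for s x
  have \<rho>: "s @ [\<rho> s x] \<in> T" "distance G x (\<tau> (s @ [\<rho> s x])) \<le> \<Delta> (length s)"
    if "s \<in> T" "legal_II G (\<pi> s) x" for s x
    using someI_ex[OF respond[OF that]] by (simp_all add: \<rho>_def)
  define pos where "pos = foldl (\<lambda>s x. s @ [\<rho> s x]) []"
  have "winning_I G N (fatten_seqs G \<Delta> Y) (\<lambda>xs. \<pi> (pos xs))"
    unfolding winning_I_def
  proof (intro allI impI conjI)
    fix x :: "nat \<Rightarrow> 'x" and c
    assume "\<forall>n. c n = \<pi> (pos (map x [0..<n]))"
    then have c: "\<And>n. c n = \<pi> (pos (map x [0..<n]))" by blast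
    define m where "m n = \<rho> (pos (map x [0..<n])) (x n)" for n
    have pos_eq: "pos (map x [0..<n]) = map m [0..<n]" for n
      by (induction n) (auto simp: pos_def m_def)
    have m: "m n = \<rho> (map m [0..<n]) (x n)" for n
      by (simp only: m_def[of n] pos_eq)
    have in_T: "map m [0..<n] \<in> T" if "\<forall>i<n. legal_II G (c i) (x i)" for n
      using that
    proof (induction n)
      case (Suc n)
      then show ?case
        using \<rho>(1)[of "map m [0..<n]" "x n"] m[of n] by (simp add: c pos_eq)
    qed (use T in simp)
    show "c n \<in> N" if "\<forall>i<n. legal_II G (c i) (x i)" for n
      using \<pi>[OF in_T[OF that]] by (simp add: c pos_eq)
    assume legal: "\<forall>n. legal_II G (c n) (x n)"
    define y where "y n = \<tau> (map m [0..<Suc n])" for n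
    have "m n \<in> M" for n
      using in_T[of "Suc n"] legal T(1) by auto
    then have "y \<in> Y"
      using \<tau>[unfolded winning_II_def, rule_format, of y m, OF y_def] by blast
    moreover have "distance G (x n) (y n) \<le> \<Delta> n" for n
      using \<rho>(2)[OF in_T[of n], of "x n"] legal m[of n] by (simp add: y_def c pos_eq)
    moreover have "x \<in> seqs G"
      using legal by (auto simp: seqs_def legal_II_def)
    ultimately show "x \<in> fatten_seqs G \<Delta> Y"
      by (auto simp: fatten_seqs_def)
  qed
  then show ?thesis by blast
qed

text \<open>Half of the error is spent on the pigeonhole principle, and half on replacing an arbitrary
  answer of II by one from the countable tree.\<close>

proposition II_in_G_imp_I_in_F:
  assumes pigeonhole: "pigeonhole_principle G" and p: "p \<in> conds G"
    and \<Delta>: "\<And>n. \<Delta> n > 0" and II: "II_reaches_in_G G p Y"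
  obtains q where "q \<in> conds G" "q \<preceq> p" "I_reaches_in_F G q (fatten_seqs G \<Delta> Y)"
proof -
  interpret X: Metric_space "topspace (pts G)" "distance G" by (rule metric)
  have sep: "separable_space X.mtopology"
    using pts_Polish by (simp add: metric_compatible Polish_space_def)
  let ?M = "moves_G G p"
  obtain \<tau> where \<tau>: "winning_II G ?M Y \<tau>"
    using II by (auto simp: II_reaches_in_G_def)
  note answer = winning_II_legal[OF \<tau>]
  have "\<exists>J. countable J \<and> J \<subseteq> ?M \<and> (s \<in> lists ?M \<longrightarrow> (\<forall>r\<in>?M. \<forall>e>0. \<exists>j\<in>J.
      distance G (\<tau> (s @ [r])) (\<tau> (s @ [j])) < e))" for s
  proof (cases "s \<in> lists ?M")
    case True
    have "\<tau> (s @ [r]) \<in> topspace (pts G)" if "r \<in> ?M" for r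
      using answer[OF True that] by (simp add: legal_II_def)
    from X.countable_dense_subfamily[OF sep, of ?M "\<lambda>r. \<tau> (s @ [r])", OF this] show ?thesis
      by (metis (lifting))
  qed auto
  then obtain J where J: "\<And>s. countable (J s)" "\<And>s. J s \<subseteq> ?M"
    "\<And>s r e. \<lbrakk>s \<in> lists ?M; r \<in> ?M; e > 0\<rbrakk>
      \<Longrightarrow> \<exists>j\<in>J s. distance G (\<tau> (s @ [r])) (\<tau> (s @ [j])) < e"
    by metis
  define T where "T = move_tree J"
  have T: "T \<subseteq> lists ?M" "[] \<in> T" "countable T"
    unfolding T_def
    by (rule move_tree_subset_lists[OF J(2)], rule move_tree.Nil, rule countable_move_tree[OF J(1)])
  then have "T \<noteq> {}" by blast
  define near where "near s = fatten G (\<Delta> (length s) / 2) ((\<lambda>r. \<tau> (s @ [r])) ` ?M)" for s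
  have dense: "\<exists>b\<in>conds G. b \<preceq> a \<and> below_set G b (near s)"
    if "s \<in> T" "a \<in> conds G" "a \<preceq> p" for s a
    unfolding near_def
  proof (rule pigeonhole_near_answers[OF pigeonhole])
    show "b \<in> ?M" if "a \<in> ?M" "b \<in> conds G" "b \<preceq> a" for a b
      using that below_trans unfolding moves_G_def by blast
    show "legal_II G r (\<tau> (s @ [r]))" if "r \<in> ?M" for r
      using answer \<open>s \<in> T\<close> T(1) that by blast
  qed (use that \<Delta> in \<open>auto simp: moves_G_def\<close>)
  obtain q where q: "q \<in> conds G" "q \<preceq> p"
    "\<And>k. \<exists>r\<in>moves_F G q. below_set G r (near (from_nat_into T k))"
  proof (rule fusion[OF p, of "\<lambda>k r. below_set G r (near (from_nat_into T k))"])
    show "\<exists>b\<in>conds G. b \<preceq> a \<and> below_set G b (near (from_nat_into T k))"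
      if "a \<in> conds G" "a \<preceq> p" for k a
      using dense[OF from_nat_into[OF \<open>T \<noteq> {}\<close>] that] .
    show "below_set G b (near (from_nat_into T k))"
      if "a \<in> conds G" "b \<in> conds G" "b \<preceq> a" "below_set G a (near (from_nat_into T k))" for k a b
      using below_set_mono[OF that(4,1,2,3)] .
  qed (use that in blast)
  have "\<exists>r\<in>moves_F G q. below_set G r (near s)" if "s \<in> T" for s
    using q(3)[of "to_nat_on T s"] that T(3) by simp
  then obtain \<pi> where \<pi>: "\<And>s. s \<in> T \<Longrightarrow> \<pi> s \<in> moves_F G q"
    "\<And>s. s \<in> T \<Longrightarrow> below_set G (\<pi> s) (near s)"
    by metis
  have "I_reaches_in_F G q (fatten_seqs G \<Delta> Y)"
    unfolding I_reaches_in_F_def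
  proof (rule I_shadows_II[OF \<tau> T(1,2) \<pi>(1)])
    fix s x assume s: "s \<in> T" and x: "legal_II G (\<pi> s) x"
    have sM: "s \<in> lists ?M" using s T(1) by blast
    have "x \<in> near s"
      using \<pi>(2)[OF s] x by (auto simp: below_set_def legal_II_def)
    then obtain r where r: "r \<in> ?M" "distance G x (\<tau> (s @ [r])) \<le> \<Delta> (length s) / 2"
      by (auto simp: near_def fatten_def)
    obtain j where j: "j \<in> J s" "distance G (\<tau> (s @ [r])) (\<tau> (s @ [j])) < \<Delta> (length s) / 2"
      using J(3)[OF sM r(1)] \<Delta> half_gt_zero by blast
    have "x \<in> topspace (pts G)" "\<tau> (s @ [r]) \<in> topspace (pts G)" "\<tau> (s @ [j]) \<in> topspace (pts G)"
      using x answer[OF sM] r(1) j(1) J(2) by (auto simp: legal_II_def)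
    then have "distance G x (\<tau> (s @ [j])) \<le> \<Delta> (length s)"
      using X.triangle[of x "\<tau> (s @ [r])" "\<tau> (s @ [j])"] r(2) j(2) by linarith
    moreover have "s @ [j] \<in> T"
      using s j(1) move_tree.snoc by (auto simp: T_def)
    ultimately show "\<exists>r. s @ [r] \<in> T \<and> distance G x (\<tau> (s @ [r])) \<le> \<Delta> (length s)"
      by blast
  qed
  then show thesis
    by (rule that[OF q(1,2)])
qed

lemma fatten_seqs_twice:
  assumes "Y \<subseteq> seqs G"
  shows "fatten_seqs G \<Gamma> (fatten_seqs G \<Delta> Y) \<subseteq> fatten_seqs G (\<lambda>n. \<Gamma> n + \<Delta> n) Y"
proof
  interpret X: Metric_space "topspace (pts G)" "distance G" by (rule metric)
  fix x assume "x \<in> fatten_seqs G \<Gamma> (fatten_seqs G \<Delta> Y)"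
  then obtain y z where xyz: "x \<in> seqs G" "y \<in> seqs G" "z \<in> Y"
    "\<And>n. distance G (x n) (y n) \<le> \<Gamma> n" "\<And>n. distance G (y n) (z n) \<le> \<Delta> n"
    unfolding fatten_seqs_def by auto
  have "distance G (x n) (z n) \<le> \<Gamma> n + \<Delta> n" for n
  proof -
    have "x n \<in> topspace (pts G)" "y n \<in> topspace (pts G)" "z n \<in> topspace (pts G)"
      using xyz(1-3) assms by (auto simp: seqs_def)
    from X.triangle[OF this] show ?thesis
      using xyz(4,5)[of n] by linarith
  qed
  with xyz show "x \<in> fatten_seqs G (\<lambda>n. \<Gamma> n + \<Delta> n) Y"
    by (auto simp: fatten_seqs_def)
qed

end

lemma I_reaches_in_F_mono:
  "\<lbrakk>I_reaches_in_F G q Y; Y \<subseteq> Z\<rbrakk> \<Longrightarrow> I_reaches_in_F G q Z"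
  unfolding I_reaches_in_F_def winning_I_def by blast

theorem corollary4p11:
  fixes G :: "('p, 'x) gowers_sextuple"
    and S :: "(nat \<Rightarrow> 'x) set" and p :: 'p and \<Delta> :: "nat \<Rightarrow> real"
  assumes "approximate_gowers_space G"
    and "pigeonhole_principle G"
    and "strategically_Ramsey G S"
    and "p \<in> conds G"
    and "\<And>n. \<Delta> n > 0"
  shows "\<exists>q \<in> conds G. q \<preceq>\<^bsub>G\<^esub> p \<and>
    (I_reaches_in_F G q (seqs G - S) \<or> I_reaches_in_F G q (fatten_seqs G \<Delta> S))"
proof -
  interpret approximate_gowers_space G by fact
  define \<Gamma> where "\<Gamma> n = \<Delta> n / 2" for n
  have \<Gamma>: "\<And>n. \<Gamma> n > 0" using assms(5) by (simp add: \<Gamma>_def)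
  have S: "S \<subseteq> seqs G" using assms(3) by (simp add: strategically_Ramsey_def)
  obtain a where a: "a \<in> conds G" "a \<preceq>\<^bsub>G\<^esub> p"
    "I_reaches_in_F G a (seqs G - S) \<or> II_reaches_in_G G a (fatten_seqs G \<Gamma> S)"
    using assms(3,4) \<Gamma> unfolding strategically_Ramsey_def by meson
  from a(3) show ?thesis
  proof
    assume "I_reaches_in_F G a (seqs G - S)"
    then show ?thesis
      by (intro bexI[of _ a] conjI disjI1 a(1,2))
  next
    assume "II_reaches_in_G G a (fatten_seqs G \<Gamma> S)"
    then obtain q where q: "q \<in> conds G" "q \<preceq>\<^bsub>G\<^esub> a"
      "I_reaches_in_F G q (fatten_seqs G \<Gamma> (fatten_seqs G \<Gamma> S))"
      by (rule II_in_G_imp_I_in_F[OF assms(2) a(1) \<Gamma>])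
    have "fatten_seqs G \<Gamma> (fatten_seqs G \<Gamma> S) \<subseteq> fatten_seqs G \<Delta> S"
      using fatten_seqs_twice[OF S, of \<Gamma> \<Gamma>] by (simp add: \<Gamma>_def)
    with q(3) have "I_reaches_in_F G q (fatten_seqs G \<Delta> S)"
      by (rule I_reaches_in_F_mono)
    then show ?thesis
      by (intro bexI[of _ q] conjI disjI2 q(1) below_trans[OF q(2) a(2)])
  qed
qed

end
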